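(* Let $H=(V,E)$ be a hypergraph, $S\subset V$, and $x\in\mathbb{R}^{|E|}$ such that $|S|\ge 2$, $x(V)=|V|-1$, and $x(S)>|S|-1$. Let $\bar K=(\bar V,\bar E)$ be the support subhypergraph of $H$ (with respect to $x$) induced by $V-S$. Let $(V_1,E_1),(V_2,E_2),\ldots,(V_k,E_k)$ be the connected components of $\bar K$, and let $S_i=V-V_i$ for $1\le i\le k$. Then there is at least one $i$, $1\le i\le k$, for which $x(S_i)>|S_i|-1$.
   Context: A hypergraph $H=(V,E)$ consists of a finite set $V$ of vertices and a set $E$ of edges, each edge $e\in E$ being a subset $e\subseteq V$ with $|e|\ge 2$. A vector $x\in\mathbb{R}^{|E|}$ has one coordinate $x_e$ per edge $e\in E$. For $S\subseteq V$, define $$x(S)=\sum_{e\in E}\max(|e\cap S|-1,\,0)\,x_e .$$ The notation $S\subset V$ means proper subset. The support hypergraph of $H$ with respect to $x$ is $(V,\{e\in E: x_e>0\})$. The support subhypergraph of $H$ induced by a vertex set $W\subseteq V$ has vertex set $W$ and edge set $\{e\cap W : e\in E,\ x_e>0,\ |e\cap W|\ge 2\}$. Two vertices lie in the same connected component of a hypergraph if they are joined by a sequence of edges in which consecutive edges intersect; a vertex contained in no edge forms a connected component by itself. *)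

theory Defs
  imports Complex_Main
begin

type_synonym 'a hypergraph = "'a set \<times> 'a set set"

fun hypergraph :: "'a hypergraph \<Rightarrow> bool" where
  "hypergraph (V, E) \<longleftrightarrow> finite V \<and> (\<forall>e\<in>E. e \<subseteq> V \<and> card e \<ge> 2)"

text \<open>A vector with one real coordinate per edge is a function on vertex sets of which only the
  values on \<open>E\<close> are ever used. No sign condition is imposed on it. The term below is
  \<open>x(S)\<close> for the edge set \<open>E\<close>.\<close>

definition edge_weight :: "'a set set \<Rightarrow> ('a set \<Rightarrow> real) \<Rightarrow> 'a set \<Rightarrow> real" where
  "edge_weight E x S = (\<Sum>e\<in>E. max (real (card (e \<inter> S)) - 1) 0 * x e)"

fun support_hypergraph :: "'a hypergraph \<Rightarrow> ('a set \<Rightarrow> real) \<Rightarrow> 'a hypergraph" where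
  "support_hypergraph (V, E) x = (V, {e \<in> E. x e > 0})"

fun induced_subhypergraph :: "'a hypergraph \<Rightarrow> 'a set \<Rightarrow> 'a hypergraph" where
  "induced_subhypergraph (V, E) W = (W, {e \<inter> W | e. e \<in> E \<and> card (e \<inter> W) \<ge> 2})"

definition joined_by_edges :: "'a set set \<Rightarrow> 'a \<Rightarrow> 'a \<Rightarrow> bool" where
  "joined_by_edges E u v \<longleftrightarrow>
     (\<exists>es. es \<noteq> [] \<and> set es \<subseteq> E \<and> u \<in> hd es \<and> v \<in> last es \<and>
           successively (\<lambda>e f. e \<inter> f \<noteq> {}) es)"

text \<open>The disjunct \<open>u = v\<close> makes a vertex lying in no edge a component by itself.\<close>

fun component_verts :: "'a hypergraph \<Rightarrow> 'a \<Rightarrow> 'a set" where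
  "component_verts (V, E) v = {u \<in> V. u = v \<or> joined_by_edges E v u}"

fun connected_components :: "'a hypergraph \<Rightarrow> 'a hypergraph set" where
  "connected_components (V, E) =
     {(C, {e \<in> E. e \<subseteq> C}) | C. C \<in> component_verts (V, E) ` V}"

end

theory Submission
  imports Defs "HOL-Library.Disjoint_Sets"
begin

text \<open>Deleting a set \<open>C\<close> from an edge \<open>e\<close> with at least two vertices lowers the coefficient of
  \<open>x\<^sub>e\<close> by \<open>min (|e \<inter> C|) (|e| - 1)\<close>. Sum this loss over the components of the support on
  \<open>V - S\<close>. An edge of positive weight meets at most one component, so its losses add up to the
  loss for \<open>V - S\<close>. For the other edges they add up to at least that loss, and the weight is
  nonpositive. Hence the total of \<open>x(V) - x(S\<^sub>i)\<close> is at most \<open>x(V) - x(S)\<close>, which is less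
  than \<open>|V - S|\<close>, the total of the \<open>|V\<^sub>i|\<close>; so \<open>x(V) - x(S\<^sub>i) < |V\<^sub>i|\<close> for some \<open>i\<close>.\<close>

lemma joined_by_edges_sym:
  assumes "joined_by_edges E u v"
  shows "joined_by_edges E v u"
proof -
  obtain es where "es \<noteq> []" "set es \<subseteq> E" "u \<in> hd es" "v \<in> last es"
    "successively (\<lambda>e f. e \<inter> f \<noteq> {}) es"
    using assms by (auto simp: joined_by_edges_def)
  then have "rev es \<noteq> [] \<and> set (rev es) \<subseteq> E \<and> v \<in> hd (rev es) \<and> u \<in> last (rev es) \<and>
    successively (\<lambda>e f. e \<inter> f \<noteq> {}) (rev es)"
    by (simp add: hd_rev last_rev successively_rev Int_commute)
  then show ?thesis
    unfolding joined_by_edges_def by blast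
qed

lemma joined_by_edges_trans:
  assumes "joined_by_edges E u v" and "joined_by_edges E v w"
  shows "joined_by_edges E u w"
proof -
  obtain es where es: "es \<noteq> []" "set es \<subseteq> E" "u \<in> hd es" "v \<in> last es"
    "successively (\<lambda>e f. e \<inter> f \<noteq> {}) es"
    using assms(1) by (auto simp: joined_by_edges_def)
  obtain fs where fs: "fs \<noteq> []" "set fs \<subseteq> E" "v \<in> hd fs" "w \<in> last fs"
    "successively (\<lambda>e f. e \<inter> f \<noteq> {}) fs"
    using assms(2) by (auto simp: joined_by_edges_def)
  \<comment> \<open>At the junction, \<open>last es\<close> and \<open>hd fs\<close> intersect
    because both contain \<open>v\<close>.\<close>
  have "es @ fs \<noteq> [] \<and> set (es @ fs) \<subseteq> E \<and> u \<in> hd (es @ fs) \<and> w \<in> last (es @ fs) \<and>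
    successively (\<lambda>e f. e \<inter> f \<noteq> {}) (es @ fs)"
    using es fs by (auto simp: successively_append_iff)
  then show ?thesis
    unfolding joined_by_edges_def by blast
qed

lemma joined_by_edges_edge:
  assumes "e \<in> E" "u \<in> e" "v \<in> e"
  shows "joined_by_edges E u v"
  unfolding joined_by_edges_def using assms by (intro exI[of _ "[e]"]) auto

text \<open>Chains can be reversed and concatenated, and the disjunct \<open>u = v\<close> supplies
  reflexivity, so the components are equivalence classes.\<close>

lemma component_verts_partition: "partition_on V (component_verts (V, E) ` V)"
proof (rule partition_onI)
  fix C D assume "C \<in> component_verts (V, E) ` V" "D \<in> component_verts (V, E) ` V" "C \<noteq> D"
  then show "disjnt C D"
    by (auto simp: disjnt_iff; metis joined_by_edges_sym joined_by_edges_trans)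
qed auto

lemma edge_subset_component_verts:
  assumes "e \<in> E" "e \<subseteq> V" "v \<in> e"
  shows "e \<subseteq> component_verts (V, E) v"
  using assms joined_by_edges_edge[of e E v] by auto

text \<open>The cap \<open>card e - 1\<close> is the whole coefficient of \<open>e\<close> at
  \<open>V\<close>: it is lost as soon as at most one vertex of \<open>e\<close> survives, where
  \<open>max\<close> cuts off at 0.\<close>

lemma edge_coefficient_diff:
  assumes "finite e" "card e \<ge> 2" "e \<subseteq> V"
  shows "max (real (card (e \<inter> V)) - 1) 0 - max (real (card (e \<inter> (V - C))) - 1) 0 =
    real (min (card (e \<inter> C)) (card e - 1))"
proof -
  have "e \<inter> V = e" and "e \<inter> (V - C) = e - C"
    using assms(3) by auto
  moreover have "card (e - C) + card (e \<inter> C) = card e"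
    using assms(1) by (metis add.commute card_Diff_subset_Int card_mono finite_Int inf_le1
        le_add_diff_inverse)
  ultimately show ?thesis
    using assms(2) by (auto simp: max_def min_def of_nat_diff)
qed

lemma edge_weight_diff:
  assumes "hypergraph (V, E)"
  shows "edge_weight E x V - edge_weight E x (V - C) =
    (\<Sum>e\<in>E. real (min (card (e \<inter> C)) (card e - 1)) * x e)"
  unfolding edge_weight_def sum_subtractf[symmetric]
proof (rule sum.cong)
  fix e assume "e \<in> E"
  then have "finite e" "card e \<ge> 2" "e \<subseteq> V"
    using assms by (auto intro: finite_subset)
  then show "max (real (card (e \<inter> V)) - 1) 0 * x e - max (real (card (e \<inter> (V - C))) - 1) 0 * x e =
    real (min (card (e \<inter> C)) (card e - 1)) * x e"
    by (simp only: left_diff_distrib[symmetric] edge_coefficient_diff)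
qed simp

text \<open>Either some term already reaches \<open>b\<close>, or no term is truncated; negative
  terms are excluded by the type. This bounds the losses of edges of nonpositive weight.\<close>

lemma min_sum_le_sum_min:
  fixes f :: "'b \<Rightarrow> nat"
  assumes "finite A"
  shows "min (\<Sum>a\<in>A. f a) b \<le> (\<Sum>a\<in>A. min (f a) b)"
  using assms by induction auto

lemma card_Int_partition:
  assumes "finite W" "partition_on W P"
  shows "card (e \<inter> W) = (\<Sum>C\<in>P. card (e \<inter> C))"
proof -
  have "e \<inter> W = (\<Union>C\<in>P. e \<inter> C)"
    using partition_onD1[OF assms(2)] by auto
  also have "card \<dots> = (\<Sum>C\<in>P. card (e \<inter> C))"
  proof (rule card_UN_disjoint)
    show "finite P"
      using finite_elements[OF assms] .
    show "\<forall>C\<in>P. finite (e \<inter> C)"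
      using assms partition_onD1[OF assms(2)] by (auto intro: finite_subset)
    show "\<forall>C\<in>P. \<forall>D\<in>P. C \<noteq> D \<longrightarrow> e \<inter> C \<inter> (e \<inter> D) = {}"
      using disjointD[OF partition_onD2[OF assms(2)]] by blast
  qed
  finally show ?thesis .
qed

text \<open>All parts other than \<open>C\<^sub>0\<close> miss \<open>e\<close> and contribute
  \<open>min 0 b = 0\<close>, so a single term remains. This gives equality for edges of positive
  weight.\<close>

lemma sum_min_card_Int_single_part:
  assumes "finite P" "disjoint P" "C\<^sub>0 \<in> P" "e \<inter> \<Union>P \<subseteq> C\<^sub>0"
  shows "(\<Sum>C\<in>P. min (card (e \<inter> C)) b) = min (card (e \<inter> \<Union>P)) b"
proof -
  have "(\<Sum>C\<in>P. min (card (e \<inter> C)) b) = (\<Sum>C\<in>{C\<^sub>0}. min (card (e \<inter> C)) b)"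
  proof (rule sum.mono_neutral_right)
    show "\<forall>C\<in>P - {C\<^sub>0}. min (card (e \<inter> C)) b = 0"
    proof
      fix C assume "C \<in> P - {C\<^sub>0}"
      then have "e \<inter> C = {}"
        using assms(3,4) disjointD[OF assms(2), of C C\<^sub>0] by blast
      then show "min (card (e \<inter> C)) b = 0"
        by simp
    qed
  qed (use assms in auto)
  moreover have "e \<inter> \<Union>P = e \<inter> C\<^sub>0"
    using assms(3,4) by auto
  ultimately show ?thesis
    by simp
qed

text \<open>A trace \<open>e \<inter> W\<close> with at least two vertices is itself an edge of the
  induced hypergraph, hence connected; a smaller one has at most one vertex to place.\<close>

lemma support_edge_subset_component:
  assumes "induced_subhypergraph (support_hypergraph (V, E) x) W = (W, F)"
    and "e \<in> E" "x e > 0" "finite W" "W \<noteq> {}"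
  shows "\<exists>C \<in> component_verts (W, F) ` W. e \<inter> W \<subseteq> C"
proof (cases "card (e \<inter> W) \<ge> 2")
  case True
  then have "e \<inter> W \<noteq> {}"
    by (intro notI) simp
  then obtain v where v: "v \<in> e \<inter> W"
    by blast
  have "e \<inter> W \<in> F"
    using assms(1-3) True by auto
  then have "e \<inter> W \<subseteq> component_verts (W, F) v"
    using v by (intro edge_subset_component_verts) auto
  then show ?thesis
    using v by blast
next
  case False
  then have unique: "u = w" if "u \<in> e \<inter> W" "w \<in> e \<inter> W" for u w
    using that assms(4) card_le_Suc0_iff_eq[of "e \<inter> W"] by auto
  \<comment> \<open>If the trace is empty, any vertex of \<open>W\<close> serves; this is where
    \<open>W \<noteq> {}\<close> enters.\<close>
  have "\<exists>v\<in>W. e \<inter> W \<subseteq> {v}"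
    using unique assms(5) by (cases "e \<inter> W = {}") blast+
  then obtain v where v: "v \<in> W" "e \<inter> W \<subseteq> {v}"
    by blast
  moreover have "v \<in> component_verts (W, F) v"
    using v by simp
  ultimately show ?thesis
    by blast
qed

theorem theorem5p5:
  fixes V S :: "'a set" and E :: "'a set set" and x :: "'a set \<Rightarrow> real"
  assumes "hypergraph (V, E)"
    and "S \<subset> V"
    and "card S \<ge> 2"
    and "edge_weight E x V = real (card V) - 1"
    and "edge_weight E x S > real (card S) - 1"
  shows "\<exists>(V\<^sub>i, E\<^sub>i) \<in> connected_components
                     (induced_subhypergraph (support_hypergraph (V, E) x) (V - S)).
           edge_weight E x (V - V\<^sub>i) > real (card (V - V\<^sub>i)) - 1"
proof (rule ccontr)
  assume contra: "\<not> ?thesis"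
  define W where "W = V - S"
  obtain F where F: "induced_subhypergraph (support_hypergraph (V, E) x) W = (W, F)"
    by simp
  define P where "P = component_verts (W, F) ` W"
  define l where "l e C = real (min (card (e \<inter> C)) (card e - 1))" for e C :: "'a set"
  have fin: "finite V" "finite W" and W: "W \<noteq> {}" "W \<subseteq> V" "V - W = S"
    using assms(1,2) by (auto simp: W_def)
  have P: "partition_on W P"
    unfolding P_def by (rule component_verts_partition)
  have finP: "finite P" and WP: "W = \<Union>P"
    using finite_elements[OF fin(2) P] partition_onD1[OF P] by auto

  \<comment> \<open>If the claim fails at \<open>C\<close>, then x(V - C) \<le> |V| - |C| - 1;
    subtracting this from x(V) = |V| - 1 shows that removing \<open>C\<close> loses at least
    |C|.\<close>
  have small: "real (card C) \<le> (\<Sum>e\<in>E. l e C * x e)" if "C \<in> P" for C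
  proof -
    have "(C, {e \<in> F. e \<subseteq> C}) \<in> connected_components (W, F)"
      using that by (auto simp: P_def)
    then have "edge_weight E x (V - C) \<le> real (card (V - C)) - 1"
      using contra unfolding F[unfolded W_def] W_def by (meson case_prodI not_le)
    moreover have "C \<subseteq> V"
      using that WP W(2) by auto
    then have "real (card (V - C)) = real (card V) - real (card C)"
      using fin(1) by (simp add: card_Diff_subset finite_subset card_mono of_nat_diff)
    ultimately show ?thesis
      using edge_weight_diff[OF assms(1), of x C] assms(4) by (simp add: l_def)
  qed

  have edge: "(\<Sum>C\<in>P. l e C) * x e \<le> l e W * x e" if e: "e \<in> E" for e
  proof (cases "x e > 0")
    case True
    then obtain C\<^sub>0 where "C\<^sub>0 \<in> P" "e \<inter> W \<subseteq> C\<^sub>0"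
      using support_edge_subset_component[OF F e _ fin(2) W(1)] unfolding P_def by blast
    then have "(\<Sum>C\<in>P. min (card (e \<inter> C)) (card e - 1)) = min (card (e \<inter> W)) (card e - 1)"
      using sum_min_card_Int_single_part[OF finP partition_onD2[OF P]] WP by simp
    then show ?thesis
      unfolding l_def by (simp flip: of_nat_sum)
  next
    case False
    have "min (card (e \<inter> W)) (card e - 1) \<le> (\<Sum>C\<in>P. min (card (e \<inter> C)) (card e - 1))"
      unfolding card_Int_partition[OF fin(2) P] by (rule min_sum_le_sum_min[OF finP])
    then have "l e W \<le> (\<Sum>C\<in>P. l e C)"
      unfolding l_def of_nat_sum[symmetric] of_nat_le_iff .
    \<comment> \<open>Multiplying by the nonpositive \<open>x e\<close> reverses the inequality
      between the losses.\<close>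
    then show ?thesis
      using False by (intro mult_right_mono_neg) auto
  qed

  \<comment> \<open>Taking \<open>UNIV\<close> for the edge turns the traces into the parts
    themselves.\<close>
  have "real (card W) = (\<Sum>C\<in>P. real (card C))"
    using card_Int_partition[OF fin(2) P, of UNIV] by simp
  also have "\<dots> \<le> (\<Sum>C\<in>P. \<Sum>e\<in>E. l e C * x e)"
    by (intro sum_mono small)
  \<comment> \<open>Exchanging the sums collects the losses edge by edge, where the components can
    be compared with \<open>W\<close> as a whole.\<close>
  also have "\<dots> = (\<Sum>e\<in>E. (\<Sum>C\<in>P. l e C) * x e)"
    unfolding sum_distrib_right by (rule sum.swap)
  also have "\<dots> \<le> (\<Sum>e\<in>E. l e W * x e)"
    by (intro sum_mono edge)
  also have "\<dots> = edge_weight E x V - edge_weight E x S"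
    using edge_weight_diff[OF assms(1), of x W] W(3) by (simp add: l_def)
  \<comment> \<open>The two terms -1 cancel, and the strictness comes from the assumption on
    \<open>S\<close>.\<close>
  also have "\<dots> < real (card V) - real (card S)"
    using assms(4,5) by simp
  also have "\<dots> = real (card W)"
    using psubset_imp_subset[OF assms(2)] fin(1) unfolding W_def
    by (simp add: card_Diff_subset finite_subset card_mono of_nat_diff)
  finally show False
    by simp
qed

end
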